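(* Let $G = (V,E)$ be a directed graph and $s,t \in V$ such that $G$ contains an $s$-$t$-path. Let $E' := \{e \in E : e \text{ lies on an } s\text{-}t\text{-path or on a directed cycle in } G\}$. Then $S \subseteq E$ is identifying for $X^{\mathrm{flow}}_{G,s,t}$ if and only if the graph $(V, E'\setminus S)$ contains no undirected cycle.
   Context: $X^{\mathrm{flow}}_{G,s,t}$ is the set of all $s$-$t$-flows of value $1$ in $G$, i.e., all $x \in \mathbb{R}_+^E$ with $\sum_{e\in\delta^-(v)}x_e - \sum_{e\in\delta^+(v)}x_e = b_v$ for all $v\in V$, where $\delta^+(v)$, $\delta^-(v)$ are the arcs leaving/entering $v$ and $b_s=-1$, $b_t=1$, $b_v=0$ otherwise. A set $S \subseteq E$ is identifying for $X$ if for all $x, x' \in X$ with $x \neq x'$ there is $e \in S$ with $x_e \neq x'_e$. An undirected cycle is a cycle in the underlying undirected (multi)graph, ignoring arc directions. *)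

theory Defs
  imports Complex_Main "HOL-Library.FuncSet" "Graph_Theory.Graph_Theory"
begin

(* For s \<noteq> t this is b_s = -1, b_t = 1 and b_v = 0 otherwise. For s = t, where those
   prescriptions conflict, a unit enters and leaves at the same vertex, giving b = 0. *)
definition flow_balance :: "'a \<Rightarrow> 'a \<Rightarrow> 'a \<Rightarrow> real" where
  "flow_balance s t v = of_bool (v = t) - of_bool (v = s)"

(* Vectors indexed by the arc set are extensional functions, so that equality of functions
   is equality of vectors. *)
definition unit_flows :: "('a, 'b) pre_digraph \<Rightarrow> 'a \<Rightarrow> 'a \<Rightarrow> ('b \<Rightarrow> real) set" where
  "unit_flows G s t =
    {x \<in> arcs G \<rightarrow>\<^sub>E {0..}.
      \<forall>v \<in> verts G. (\<Sum>e \<in> in_arcs G v. x e) - (\<Sum>e \<in> out_arcs G v. x e) = flow_balance s t v}"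

definition identifying :: "'b set \<Rightarrow> ('b \<Rightarrow> real) set \<Rightarrow> bool" where
  "identifying S X \<longleftrightarrow> (\<forall>x \<in> X. \<forall>x' \<in> X. x \<noteq> x' \<longrightarrow> (\<exists>e \<in> S. x e \<noteq> x' e))"

definition path_or_cycle_arcs :: "('a, 'b) pre_digraph \<Rightarrow> 'a \<Rightarrow> 'a \<Rightarrow> 'b set" where
  "path_or_cycle_arcs G s t =
    {e \<in> arcs G. (\<exists>p. pre_digraph.apath G s p t \<and> e \<in> set p)
               \<or> (\<exists>p. pre_digraph.cycle G p \<and> e \<in> set p)}"

(* The cycle v_0 e_0 v_1 e_1 ... v_{k-1} e_{k-1} v_0 of the underlying undirected multigraph.
   A loop is a cycle of length 1, and two distinct (parallel or antiparallel) arcs between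
   the same two vertices form a cycle of length 2. *)
definition undirected_cycle :: "('a, 'b) pre_digraph \<Rightarrow> 'a list \<Rightarrow> 'b list \<Rightarrow> bool" where
  "undirected_cycle G vs es \<longleftrightarrow>
    es \<noteq> [] \<and> length vs = length es \<and> distinct vs \<and> distinct es \<and>
    set vs \<subseteq> verts G \<and> set es \<subseteq> arcs G \<and>
    (\<forall>i < length es. {tail G (es ! i), head G (es ! i)} = {vs ! i, vs ! (Suc i mod length es)})"

end

theory Submission
  imports Defs
begin

text \<open>
  Call an arc usable if some flow is positive on it. Two flows that agree on \<open>S\<close> differ by a
  circulation supported on usable arcs outside \<open>S\<close>. In the support of a circulation no vertex is a
  leaf, so a longest undirected path in it closes up to an undirected cycle. Conversely, the average
  of finitely many flows is positive wherever one of them is, and it can be perturbed along an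
  undirected cycle of usable arcs outside \<open>S\<close>. All this works for arbitrary vertex balances. For
  unit \<open>s\<close>-\<open>t\<close>-flows a cut argument identifies the usable arcs as those on \<open>s\<close>-\<open>t\<close>-paths and
  directed cycles.
\<close>

subsection \<open>Arcs on paths and cycles\<close>

context wf_digraph
begin

lemma reachable_head_if_arc:
  "e \<in> arcs G \<Longrightarrow> tail G e \<rightarrow>\<^sup>* head G e"
  by (intro reachable_adjI in_arcs_imp_in_arcs_ends)

lemma arc_on_cycle:
  assumes e: "e \<in> arcs G" and "head G e \<rightarrow>\<^sup>* tail G e"
  shows "\<exists>p. cycle p \<and> e \<in> set p"
proof -
  obtain q where "apath (head G e) q (tail G e)"
    using assms by (auto simp: reachable_apath)
  then have "cycle (e # q)"
    using e unfolding cycle_def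
    by (intro exI[of _ "tail G e"]) (auto simp: awalk_Cons_iff apath_def)
  then show ?thesis
    by (intro exI[of _ "e # q"]) simp
qed

lemma arc_on_apath:
  assumes e: "e \<in> arcs G" and "s \<rightarrow>\<^sup>* tail G e" and "head G e \<rightarrow>\<^sup>* t"
    and not_back: "\<not> head G e \<rightarrow>\<^sup>* tail G e"
  shows "\<exists>p. apath s p t \<and> e \<in> set p"
proof -
  obtain p q where p: "apath s p (tail G e)" and q: "apath (head G e) q t"
    using assms(2,3) by (auto simp: reachable_apath)
  then have last: "awlast s p = tail G e"
    by (auto simp: apath_def)
  have "w \<notin> set (awalk_verts (head G e) q)" if "w \<in> set (awalk_verts s p)" for w
    using not_back that p q awalk_verts_reachable_to awalk_verts_reachable_from reachable_trans
    by (meson awalkI_apath)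
  moreover have "tail G e \<in> set (awalk_verts s p)"
    using last by (metis awalk_verts_non_Nil last_in_set)
  ultimately have "apath s (p @ e # q) t"
    using p q e last by (auto simp: apath_append_iff apath_Cons_iff)
  then show ?thesis
    by (intro exI[of _ "p @ e # q"]) simp
qed

end

subsection \<open>Net inflow\<close>

lemma flow_balance_same: "flow_balance u u v = 0"
  by (simp add: flow_balance_def)

lemma flow_balance_trans: "flow_balance u v a + flow_balance v w a = flow_balance u w a"
  by (simp add: flow_balance_def)

lemma sum_flow_balance:
  assumes "finite R"
  shows "(\<Sum>v\<in>R. flow_balance a b v) = of_bool (b \<in> R) - of_bool (a \<in> R)"
  using assms by (simp add: flow_balance_def sum_subtractf of_bool_def)

context pre_digraph
begin

definition net_inflow :: "('b \<Rightarrow> real) \<Rightarrow> 'a \<Rightarrow> real" where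
  "net_inflow x v = (\<Sum>e\<in>arcs G. x e * flow_balance (tail G e) (head G e) v)"

lemma net_inflow_cong:
  "(\<And>e. e \<in> arcs G \<Longrightarrow> x e = y e) \<Longrightarrow> net_inflow x v = net_inflow y v"
  by (simp add: net_inflow_def)

lemma net_inflow_add: "net_inflow (\<lambda>e. x e + y e) v = net_inflow x v + net_inflow y v"
  by (simp add: net_inflow_def distrib_right sum.distrib)

lemma net_inflow_diff: "net_inflow (\<lambda>e. x e - y e) v = net_inflow x v - net_inflow y v"
  by (simp add: net_inflow_def left_diff_distrib sum_subtractf)

lemma net_inflow_scale: "net_inflow (\<lambda>e. c * x e) v = c * net_inflow x v"
  by (simp add: net_inflow_def sum_distrib_left mult.assoc)

lemma net_inflow_sum: "net_inflow (\<lambda>e. \<Sum>i\<in>I. x i e) v = (\<Sum>i\<in>I. net_inflow (x i) v)"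
  unfolding net_inflow_def sum_distrib_right by (rule sum.swap)

lemma sum_net_inflow:
  assumes "finite R"
  shows "(\<Sum>v\<in>R. net_inflow x v) =
    (\<Sum>e\<in>arcs G. x e * (of_bool (head G e \<in> R) - of_bool (tail G e \<in> R)))"
  unfolding net_inflow_def
  by (subst sum.swap) (simp add: assms sum_flow_balance flip: sum_distrib_left)

end

context fin_digraph
begin

lemma net_inflow_eq_in_arcs_minus_out_arcs:
  "net_inflow x v = (\<Sum>e\<in>in_arcs G v. x e) - (\<Sum>e\<in>out_arcs G v. x e)"
proof -
  have "(\<Sum>e\<in>in_arcs G v. x e) = (\<Sum>e\<in>arcs G. x e * of_bool (v = head G e))"
    by (rule sum.mono_neutral_cong_left) auto
  moreover have "(\<Sum>e\<in>out_arcs G v. x e) = (\<Sum>e\<in>arcs G. x e * of_bool (v = tail G e))"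
    by (rule sum.mono_neutral_cong_left) auto
  ultimately show ?thesis
    by (simp add: net_inflow_def flow_balance_def right_diff_distrib sum_subtractf)
qed

lemma net_inflow_single_arc:
  assumes "a \<in> arcs G"
  shows "net_inflow (\<lambda>e. of_bool (e = a)) v = flow_balance (tail G a) (head G a) v"
proof -
  have "net_inflow (\<lambda>e. of_bool (e = a)) v =
      (\<Sum>e\<in>arcs G. if e = a then flow_balance (tail G a) (head G a) v else 0)"
    unfolding net_inflow_def by (auto intro!: sum.cong)
  then show ?thesis
    using assms by simp
qed

lemma net_inflow_awalk:
  assumes "awalk u p w"
  shows "net_inflow (\<lambda>e. real (count_list p e)) v = flow_balance u w v"
  using assms
proof (induction p arbitrary: u)
  case Nil
  then show ?case
    by (simp add: awalk_Nil_iff net_inflow_def flow_balance_def)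
next
  case (Cons a p)
  then have a: "a \<in> arcs G" "tail G a = u" and "awalk (head G a) p w"
    by (auto simp: awalk_Cons_iff)
  have "(\<lambda>e. real (count_list (a # p) e)) = (\<lambda>e. of_bool (e = a) + real (count_list p e))"
    by auto
  then show ?case
    using Cons.IH[OF \<open>awalk (head G a) p w\<close>] a
    by (simp add: net_inflow_add net_inflow_single_arc flow_balance_trans del: count_list.simps)
qed

end

subsection \<open>Flows with prescribed vertex balances\<close>

context pre_digraph
begin

definition b_flow :: "('a \<Rightarrow> real) \<Rightarrow> ('b \<Rightarrow> real) \<Rightarrow> bool" where
  "b_flow b x \<longleftrightarrow> (\<forall>e\<in>arcs G. 0 \<le> x e) \<and> (\<forall>v\<in>verts G. net_inflow x v = b v)"

definition b_flows :: "('a \<Rightarrow> real) \<Rightarrow> ('b \<Rightarrow> real) set" where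
  "b_flows b = {x \<in> extensional (arcs G). b_flow b x}"

definition usable_arcs :: "('a \<Rightarrow> real) \<Rightarrow> 'b set" where
  "usable_arcs b = {e \<in> arcs G. \<exists>x. b_flow b x \<and> 0 < x e}"

lemma restrict_in_b_flows:
  assumes "b_flow b x"
  shows "restrict x (arcs G) \<in> b_flows b"
  using assms net_inflow_cong[of "restrict x (arcs G)" x] by (simp add: b_flows_def b_flow_def)

lemma b_flow_add:
  assumes "b_flow b x" and "b_flow c y"
  shows "b_flow (\<lambda>v. b v + c v) (\<lambda>e. x e + y e)"
  using assms by (simp add: b_flow_def net_inflow_add)

lemma b_flow_average:
  assumes "finite I" and "I \<noteq> {}" and "\<And>i. i \<in> I \<Longrightarrow> b_flow b (x i)"
  shows "b_flow b (\<lambda>e. inverse (real (card I)) * (\<Sum>i\<in>I. x i e))"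
  using assms by (simp add: b_flow_def net_inflow_scale net_inflow_sum sum_nonneg)

end

context fin_digraph
begin

lemma unit_flows_eq_b_flows: "unit_flows G s t = b_flows (flow_balance s t)"
  by (auto simp: unit_flows_def b_flows_def b_flow_def net_inflow_eq_in_arcs_minus_out_arcs PiE_def)

lemma b_flow_awalk:
  assumes "awalk u p w"
  shows "b_flow (flow_balance u w) (\<lambda>e. real (count_list p e))"
  using net_inflow_awalk[OF assms] by (simp add: b_flow_def)

lemma ex_b_flow_pos_on_usable_arcs:
  assumes "F \<subseteq> usable_arcs b" and "F \<noteq> {}"
  shows "\<exists>x. b_flow b x \<and> (\<forall>e\<in>F. 0 < x e)"
proof -
  have arcs: "F \<subseteq> arcs G"
    using assms(1) by (auto simp: usable_arcs_def)
  then have "finite F"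
    by (rule finite_subset) simp
  obtain y where flow: "\<And>f. f \<in> F \<Longrightarrow> b_flow b (y f)" and pos: "\<And>f. f \<in> F \<Longrightarrow> 0 < y f f"
    using assms(1) unfolding usable_arcs_def subset_iff mem_Collect_eq by metis
  have "0 < (\<Sum>f\<in>F. y f e)" if "e \<in> F" for e
    using \<open>finite F\<close> that pos[OF that] flow arcs by (intro sum_pos2[of F e]) (auto simp: b_flow_def)
  then have "\<forall>e\<in>F. 0 < inverse (real (card F)) * (\<Sum>f\<in>F. y f e)"
    using \<open>finite F\<close> assms(2) by (simp add: card_gt_0_iff)
  then show ?thesis
    using b_flow_average[of F b y, OF \<open>finite F\<close> assms(2) flow] by blast
qed

lemma sum_balance_verts_eq_0:
  assumes "b_flow b x"
  shows "(\<Sum>v\<in>verts G. b v) = 0"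
proof -
  have "(\<Sum>v\<in>verts G. b v) = (\<Sum>v\<in>verts G. net_inflow x v)"
    using assms by (simp add: b_flow_def)
  also have "\<dots> = 0"
    by (simp add: sum_net_inflow)
  finally show ?thesis .
qed

lemma sum_balance_pos_if_no_arc_leaves:
  assumes flow: "b_flow b x" and R: "R \<subseteq> verts G"
    and no_arc_leaves: "\<And>a. a \<in> arcs G \<Longrightarrow> tail G a \<in> R \<Longrightarrow> head G a \<in> R"
    and e: "e \<in> arcs G" "0 < x e" "tail G e \<notin> R" "head G e \<in> R"
  shows "0 < (\<Sum>v\<in>R. b v)"
proof -
  have "finite R"
    using R by (rule finite_subset) simp
  have "0 < (\<Sum>a\<in>arcs G. x a * (of_bool (head G a \<in> R) - of_bool (tail G a \<in> R)))"
  proof (rule sum_pos2[OF finite_arcs \<open>e \<in> arcs G\<close>])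
    show "0 < x e * (of_bool (head G e \<in> R) - of_bool (tail G e \<in> R))"
      using e by simp
    show "0 \<le> x a * (of_bool (head G a \<in> R) - of_bool (tail G a \<in> R))" if "a \<in> arcs G" for a
      using flow that no_arc_leaves[OF that] by (auto simp: b_flow_def)
  qed
  also have "\<dots> = (\<Sum>v\<in>R. net_inflow x v)"
    using \<open>finite R\<close> by (rule sum_net_inflow[symmetric])
  also have "\<dots> = (\<Sum>v\<in>R. b v)"
    using flow R by (intro sum.cong) (auto simp: b_flow_def)
  finally show ?thesis .
qed

lemma b_flow_reaches_sink:
  assumes "b_flow b x" and "e \<in> arcs G" and "0 < x e" and "\<not> head G e \<rightarrow>\<^sup>* tail G e"
  shows "\<exists>w. head G e \<rightarrow>\<^sup>* w \<and> 0 < b w"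
proof -
  define R where "R = {w. head G e \<rightarrow>\<^sup>* w}"
  have "0 < (\<Sum>v\<in>R. b v)"
  proof (rule sum_balance_pos_if_no_arc_leaves)
    show "head G a \<in> R" if "a \<in> arcs G" "tail G a \<in> R" for a
      using that reachable_trans[OF _ reachable_head_if_arc[of a]] by (simp add: R_def)
  qed (use assms in \<open>auto simp: R_def reachable_in_verts\<close>)
  then show ?thesis
    using sum_nonpos[of R b] by (force simp: R_def)
qed

lemma b_flow_reached_from_source:
  assumes "b_flow b x" and "e \<in> arcs G" and "0 < x e" and "\<not> head G e \<rightarrow>\<^sup>* tail G e"
  shows "\<exists>w. w \<rightarrow>\<^sup>* tail G e \<and> b w < 0"
proof -
  define R where "R = {w. w \<rightarrow>\<^sup>* tail G e}"
  have R: "R \<subseteq> verts G"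
    by (auto simp: R_def reachable_in_verts)
  have "0 < (\<Sum>v\<in>verts G - R. b v)"
  proof (rule sum_balance_pos_if_no_arc_leaves)
    show "head G a \<in> verts G - R" if "a \<in> arcs G" "tail G a \<in> verts G - R" for a
      using that reachable_trans[OF reachable_head_if_arc[of a]] by (auto simp: R_def)
  qed (use assms in \<open>auto simp: R_def\<close>)
  then have "(\<Sum>v\<in>R. b v) < 0"
    using sum_balance_verts_eq_0[OF assms(1)] sum.subset_diff[OF R finite_verts, of b] by simp
  then show ?thesis
    using sum_nonneg[of R b] by (force simp: R_def)
qed

end

subsection \<open>Usable arcs of unit flows\<close>

context fin_digraph
begin

lemma usable_arcs_flow_balance_subset:
  "usable_arcs (flow_balance s t) \<subseteq> path_or_cycle_arcs G s t"
proof
  fix e assume "e \<in> usable_arcs (flow_balance s t)"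
  then obtain x where e: "e \<in> arcs G" and x: "b_flow (flow_balance s t) x" "0 < x e"
    by (auto simp: usable_arcs_def)
  show "e \<in> path_or_cycle_arcs G s t"
  proof (cases "head G e \<rightarrow>\<^sup>* tail G e")
    case True
    then show ?thesis
      using e arc_on_cycle by (simp add: path_or_cycle_arcs_def)
  next
    case False
    have "head G e \<rightarrow>\<^sup>* t"
      using b_flow_reaches_sink[OF x(1) e x(2) False]
      by (auto simp: flow_balance_def of_bool_def split: if_splits)
    moreover have "s \<rightarrow>\<^sup>* tail G e"
      using b_flow_reached_from_source[OF x(1) e x(2) False]
      by (auto simp: flow_balance_def of_bool_def split: if_splits)
    ultimately show ?thesis
      using e False arc_on_apath by (simp add: path_or_cycle_arcs_def)
  qed
qed

lemma path_or_cycle_arcs_subset_usable_arcs: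
  assumes "apath s p t"
  shows "path_or_cycle_arcs G s t \<subseteq> usable_arcs (flow_balance s t)"
proof
  fix e assume "e \<in> path_or_cycle_arcs G s t"
  then have e: "e \<in> arcs G" and "(\<exists>q. apath s q t \<and> e \<in> set q) \<or> (\<exists>q. cycle q \<and> e \<in> set q)"
    by (auto simp: path_or_cycle_arcs_def)
  then consider q where "awalk s q t" "e \<in> set q" | q u where "awalk u q u" "e \<in> set q"
    by (auto simp: cycle_def dest: awalkI_apath)
  then have "\<exists>x. b_flow (flow_balance s t) x \<and> 0 < x e"
  proof cases
    case 1
    then have "0 < real (count_list q e)"
      by (simp add: count_list_0_iff flip: neq0_conv)
    then show ?thesis
      using b_flow_awalk[OF 1(1)] by blast
  next
    case 2
    then have "0 < real (count_list p e) + real (count_list q e)"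
      by (simp add: count_list_0_iff add_nonneg_pos flip: neq0_conv)
    moreover have "b_flow (flow_balance s t) (\<lambda>a. real (count_list p a) + real (count_list q a))"
      using b_flow_add[OF b_flow_awalk[OF awalkI_apath[OF assms]] b_flow_awalk[OF 2(1)]]
      by (simp add: flow_balance_same)
    ultimately show ?thesis
      by blast
  qed
  then show "e \<in> usable_arcs (flow_balance s t)"
    using e by (simp add: usable_arcs_def)
qed

end

subsection \<open>Circulations along undirected cycles\<close>

lemma undirected_cycle_arcs_update_iff:
  assumes "A \<subseteq> arcs G"
  shows "undirected_cycle (G\<lparr>arcs := A\<rparr>) vs es \<longleftrightarrow> undirected_cycle G vs es \<and> set es \<subseteq> A"
  using assms by (auto simp: undirected_cycle_def)

lemma sum_Suc_mod:
  fixes f :: "nat \<Rightarrow> 'c::comm_monoid_add"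
  shows "(\<Sum>i<k. f (Suc i mod k)) = (\<Sum>i<k. f i)"
proof (cases k)
  case (Suc m)
  have "(\<Sum>i<k. f (Suc i mod k)) = (\<Sum>i<m. f (Suc i)) + f 0"
    by (simp add: Suc)
  also have "\<dots> = (\<Sum>i<k. f i)"
    by (simp add: Suc sum.lessThan_Suc_shift add.commute del: sum.lessThan_Suc)
  finally show ?thesis .
qed simp

context pre_digraph
begin

abbreviation ends :: "'b \<Rightarrow> 'a set" where
  "ends e \<equiv> {tail G e, head G e}"

definition traversal_sign :: "'a \<Rightarrow> 'b \<Rightarrow> real" where
  "traversal_sign v e = (if tail G e = v then 1 else - 1)"

definition cycle_circulation :: "'a list \<Rightarrow> 'b list \<Rightarrow> 'b \<Rightarrow> real" where
  "cycle_circulation vs es e =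
    (\<Sum>i<length es. traversal_sign (vs ! i) (es ! i) * of_bool (e = es ! i))"

lemma traversal_sign_flow_balance:
  assumes "ends e = {v, w}"
  shows "traversal_sign v e * flow_balance (tail G e) (head G e) u = flow_balance v w u"
  using assms by (auto simp: traversal_sign_def flow_balance_def doubleton_eq_iff)

lemma cycle_circulation_eq_0:
  assumes "e \<notin> set es"
  shows "cycle_circulation vs es e = 0"
  unfolding cycle_circulation_def using assms by (intro sum.neutral) auto

lemma abs_cycle_circulation_eq_1:
  assumes "distinct es" and "e \<in> set es"
  shows "\<bar>cycle_circulation vs es e\<bar> = 1"
proof -
  obtain j where j: "j < length es" "e = es ! j"
    using assms by (auto simp: in_set_conv_nth)
  have "cycle_circulation vs es e =
      (\<Sum>i<length es. if i = j then traversal_sign (vs ! i) (es ! i) else 0)"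
    unfolding cycle_circulation_def using j assms(1)
    by (intro sum.cong) (auto simp: nth_eq_iff_index_eq)
  then show ?thesis
    using j by (simp add: traversal_sign_def)
qed

end

context fin_digraph
begin

lemma net_inflow_cycle_circulation:
  assumes "undirected_cycle G vs es"
  shows "net_inflow (cycle_circulation vs es) v = 0"
proof -
  let ?next = "\<lambda>i. vs ! (Suc i mod length es)"
  have arcs: "es ! i \<in> arcs G" and ends: "ends (es ! i) = {vs ! i, ?next i}"
    if "i < length es" for i
    using assms that by (auto simp: undirected_cycle_def)
  have "net_inflow (cycle_circulation vs es) v =
      (\<Sum>i<length es. traversal_sign (vs ! i) (es ! i) *
        flow_balance (tail G (es ! i)) (head G (es ! i)) v)"
    unfolding cycle_circulation_def using arcs
    by (simp add: net_inflow_sum net_inflow_scale net_inflow_single_arc del: sum_mult_of_bool_eq)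
  also have "\<dots> = (\<Sum>i<length es. flow_balance (vs ! i) (?next i) v)"
    using ends by (simp add: traversal_sign_flow_balance)
  also have "\<dots> = 0"
    using sum_Suc_mod[of "\<lambda>i. of_bool (v = vs ! i) :: real" "length es"]
    by (simp add: flow_balance_def sum_subtractf)
  finally show ?thesis .
qed

lemma b_flow_perturb_along_undirected_cycle:
  assumes x: "b_flow b x" and cycle: "undirected_cycle G vs es"
    and pos: "\<And>e. e \<in> set es \<Longrightarrow> 0 < x e"
  shows "\<exists>y. b_flow b y \<and> (\<forall>e. x e \<noteq> y e \<longleftrightarrow> e \<in> set es)"
proof -
  have es: "es \<noteq> []" "distinct es"
    using cycle by (auto simp: undirected_cycle_def)
  define r where "r = Min (x ` set es)"
  have "0 < r"
    unfolding r_def using es pos by (subst Min_gr_iff) auto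
  define y where "y e = x e + r * cycle_circulation vs es e" for e
  have "0 \<le> y e" if "e \<in> arcs G" for e
  proof (cases "e \<in> set es")
    case True
    then have "r \<le> x e"
      by (simp add: r_def)
    moreover have "\<bar>r * cycle_circulation vs es e\<bar> = r"
      using abs_cycle_circulation_eq_1[OF es(2) True] \<open>0 < r\<close> by (simp add: abs_mult)
    ultimately show ?thesis
      unfolding y_def by linarith
  next
    case False
    then show ?thesis
      using x that by (simp add: y_def cycle_circulation_eq_0 b_flow_def)
  qed
  moreover have "net_inflow y v = net_inflow x v" for v
    unfolding y_def
    by (simp add: net_inflow_add net_inflow_scale net_inflow_cycle_circulation[OF cycle])
  ultimately have "b_flow b y"
    using x by (simp add: b_flow_def)
  moreover have "x e \<noteq> y e \<longleftrightarrow> e \<in> set es" for e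
    using abs_cycle_circulation_eq_1[OF es(2), of e vs] cycle_circulation_eq_0[of e es vs] \<open>0 < r\<close>
    by (auto simp: y_def)
  ultimately show ?thesis
    by blast
qed

end

subsection \<open>Undirected cycles in the support of a circulation\<close>

context pre_digraph
begin

text \<open>Loops are exempt because a loop is itself an undirected cycle.\<close>

definition leafless :: "'b set \<Rightarrow> bool" where
  "leafless A \<longleftrightarrow>
    (\<forall>e\<in>A. tail G e \<noteq> head G e \<longrightarrow> (\<forall>v\<in>ends e. \<exists>f\<in>A - {e}. v \<in> ends f))"

definition undirected_path :: "'a list \<Rightarrow> 'b list \<Rightarrow> bool" where
  "undirected_path vs es \<longleftrightarrow>
    length vs = Suc (length es) \<and> distinct vs \<and> set vs \<subseteq> verts G \<and> set es \<subseteq> arcs G \<and>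
    (\<forall>i<length es. ends (es ! i) = {vs ! i, vs ! Suc i})"

lemma undirected_path_Cons:
  assumes "undirected_path vs es" and "f \<in> arcs G" and "ends f = {w, hd vs}"
    and "w \<in> verts G" and "w \<notin> set vs"
  shows "undirected_path (w # vs) (f # es)"
proof -
  have "vs \<noteq> []"
    using assms(1) by (auto simp: undirected_path_def)
  then show ?thesis
    using assms by (auto simp: undirected_path_def nth_Cons' hd_conv_nth)
qed

lemma undirected_path_incident_iff:
  assumes "undirected_path vs es" and "i < length vs" and "l < length es"
  shows "vs ! i \<in> ends (es ! l) \<longleftrightarrow> i = l \<or> i = Suc l"
  using assms by (auto simp: undirected_path_def nth_eq_iff_index_eq)

lemma undirected_path_distinct_arcs:
  assumes path: "undirected_path vs es"
  shows "distinct es"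
  unfolding distinct_conv_nth
proof (intro allI impI)
  fix i l assume il: "i < length es" "l < length es" "i \<noteq> l"
  have "length vs = Suc (length es)"
    using path by (simp add: undirected_path_def)
  then have "i = l \<or> i = Suc l" and "l = i \<or> l = Suc i" if "es ! i = es ! l"
    using il that undirected_path_incident_iff[OF path, of i i]
      undirected_path_incident_iff[OF path, of i l] undirected_path_incident_iff[OF path, of l l]
      undirected_path_incident_iff[OF path, of l i] by simp_all
  then show "es ! i \<noteq> es ! l"
    using il(3) by auto
qed

lemma undirected_path_hd_incident_iff:
  assumes path: "undirected_path vs es" and "f \<in> set es"
  shows "hd vs \<in> ends f \<longleftrightarrow> f = hd es"
proof -
  obtain i where i: "i < length es" "f = es ! i"
    using assms(2) by (auto simp: in_set_conv_nth)
  have "0 < length vs" and "0 < length es"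
    using path i by (auto simp: undirected_path_def)
  then have "hd vs \<in> ends f \<longleftrightarrow> i = 0"
    using undirected_path_incident_iff[OF path, of 0 i] i by (simp add: hd_conv_nth)
  also have "\<dots> \<longleftrightarrow> f = es ! 0"
    using nth_eq_iff_index_eq[OF undirected_path_distinct_arcs[OF path] i(1) \<open>0 < length es\<close>] i(2)
    by simp
  also have "es ! 0 = hd es"
    using \<open>0 < length es\<close> by (simp add: hd_conv_nth)
  finally show ?thesis .
qed

lemma undirected_path_not_loop:
  assumes "undirected_path vs es" and "e \<in> set es"
  shows "tail G e \<noteq> head G e"
proof -
  obtain i where "i < length es" "e = es ! i"
    using assms(2) by (auto simp: in_set_conv_nth)
  then have "ends e = {vs ! i, vs ! Suc i}" "vs ! i \<noteq> vs ! Suc i"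
    using assms(1) by (auto simp: undirected_path_def nth_eq_iff_index_eq)
  then show ?thesis
    by (auto simp: doubleton_eq_iff)
qed

lemma undirected_cycle_if_undirected_path_closes:
  assumes path: "undirected_path vs es" and j: "j < length vs"
    and f: "f \<in> arcs G" "f \<notin> set es" "ends f = {vs ! j, hd vs}"
  shows "undirected_cycle G (take (Suc j) vs) (take j es @ [f])"
proof -
  have len: "length vs = Suc (length es)"
    and ends: "\<And>i. i < length es \<Longrightarrow> ends (es ! i) = {vs ! i, vs ! Suc i}"
    using path by (auto simp: undirected_path_def)
  have "ends ((take j es @ [f]) ! i) =
      {take (Suc j) vs ! i, take (Suc j) vs ! (Suc i mod Suc j)}" if "i < Suc j" for i
  proof (cases "i = j")
    case True
    have "vs ! 0 = hd vs"
      using j by (intro hd_conv_nth[symmetric]) auto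
    then show ?thesis
      using True f(3) j len by (simp add: nth_append)
  next
    case False
    then show ?thesis
      using that ends[of i] j len by (simp add: nth_append)
  qed
  moreover have "distinct (take j es @ [f])"
    using undirected_path_distinct_arcs[OF path] f(2) by (auto dest: in_set_takeD)
  ultimately show ?thesis
    using path j f(1) len unfolding undirected_cycle_def undirected_path_def
    by (auto dest: in_set_takeD)
qed

lemma leafless_arc_off_path_at_hd:
  assumes path: "undirected_path vs es" "set es \<subseteq> A"
    and "leafless A" and "\<exists>f\<in>A. hd vs \<in> ends f"
  shows "\<exists>f\<in>A - set es. hd vs \<in> ends f"
proof (cases es)
  case Nil
  then show ?thesis
    using assms(4) by simp
next
  case (Cons e es')
  then have "e \<in> A" and "hd vs \<in> ends e" and "tail G e \<noteq> head G e"
    using path undirected_path_hd_incident_iff[OF path(1), of e]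
      undirected_path_not_loop[OF path(1), of e] by auto
  then obtain f where "f \<in> A - {hd es}" "hd vs \<in> ends f"
    using \<open>leafless A\<close> Cons unfolding leafless_def by fastforce
  then show ?thesis
    using undirected_path_hd_incident_iff[OF path(1)] by blast
qed

end

lemma (in wf_digraph) undirected_path_extends_or_closes:
  assumes path: "undirected_path vs es" "set es \<subseteq> A" and "A \<subseteq> arcs G"
    and f: "f \<in> A" "f \<notin> set es" "hd vs \<in> ends f"
  shows "(\<exists>w. undirected_path (w # vs) (f # es) \<and> w \<in> ends f) \<or>
    (\<exists>vs' es'. undirected_cycle G vs' es' \<and> set es' \<subseteq> A)"
proof -
  obtain w where w: "ends f = {w, hd vs}"
    using f(3) by (cases "hd vs = head G f") auto
  have arc: "f \<in> arcs G"
    using f(1) assms(3) by blast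
  show ?thesis
  proof (cases "w \<in> set vs")
    case True
    then obtain j where "j < length vs" "w = vs ! j"
      by (auto simp: in_set_conv_nth)
    then have "undirected_cycle G (take (Suc j) vs) (take j es @ [f])"
      using undirected_cycle_if_undirected_path_closes[OF path(1)] arc f(2) w by blast
    moreover have "set (take j es @ [f]) \<subseteq> A"
      using path(2) f(1) by (auto dest: in_set_takeD)
    ultimately show ?thesis
      by blast
  next
    case False
    moreover have "w \<in> verts G"
      using arc w by (auto simp: doubleton_eq_iff)
    ultimately have "undirected_path (w # vs) (f # es)"
      using undirected_path_Cons[OF path(1) arc w] by blast
    then show ?thesis
      using w by blast
  qed
qed

context fin_digraph
begin

lemma undirected_path_length_less:
  assumes "undirected_path vs es"
  shows "length es < card (verts G)"
proof -
  have "length vs = card (set vs)"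
    using assms by (simp add: undirected_path_def distinct_card)
  also have "\<dots> \<le> card (verts G)"
    using assms by (intro card_mono) (auto simp: undirected_path_def)
  finally show ?thesis
    using assms by (simp add: undirected_path_def)
qed

lemma undirected_cycle_if_leafless:
  assumes "A \<subseteq> arcs G" and "A \<noteq> {}" and "leafless A"
  shows "\<exists>vs es. undirected_cycle G vs es \<and> set es \<subseteq> A"
proof -
  define path where "path vs es \<longleftrightarrow>
    undirected_path vs es \<and> set es \<subseteq> A \<and> (\<exists>f\<in>A. hd vs \<in> ends f)" for vs es
  obtain a where "a \<in> A"
    using assms(2) by blast
  then have "path [tail G a] []"
    using assms(1) by (auto simp: path_def undirected_path_def)
  then obtain es where "\<exists>vs. path vs es"
    and longest: "\<And>vs' es'. path vs' es' \<Longrightarrow> length es' \<le> length es"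
    using ex_has_greatest_nat[of "\<lambda>es. \<exists>vs. path vs es" "[]" length "card (verts G)"]
      undirected_path_length_less unfolding path_def by (metis less_imp_le)
  then obtain vs where vs: "undirected_path vs es" "set es \<subseteq> A" "\<exists>f\<in>A. hd vs \<in> ends f"
    by (auto simp: path_def)
  obtain f where f: "f \<in> A" "f \<notin> set es" "hd vs \<in> ends f"
    using leafless_arc_off_path_at_hd[OF vs(1,2) assms(3) vs(3)] by blast
  have "\<not> (undirected_path (w # vs) (f # es) \<and> w \<in> ends f)" for w
    using longest[of "w # vs" "f # es"] vs(2) f(1) by (auto simp: path_def)
  then show ?thesis
    using undirected_path_extends_or_closes[OF vs(1,2) assms(1) f] by blast
qed

lemma leafless_circulation_support:
  assumes circulation: "\<And>v. v \<in> verts G \<Longrightarrow> net_inflow d v = 0"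
  shows "leafless {a \<in> arcs G. d a \<noteq> 0}"
  unfolding leafless_def
proof (intro ballI impI)
  fix e v
  assume e: "e \<in> {a \<in> arcs G. d a \<noteq> 0}" "tail G e \<noteq> head G e" and v: "v \<in> ends e"
  show "\<exists>f\<in>{a \<in> arcs G. d a \<noteq> 0} - {e}. v \<in> ends f"
  proof (rule ccontr)
    assume "\<not> ?thesis"
    then have "net_inflow d v =
        (\<Sum>f\<in>arcs G. if f = e then d e * flow_balance (tail G e) (head G e) v else 0)"
      unfolding net_inflow_def by (intro sum.cong) (auto simp: flow_balance_def)
    also have "\<dots> \<noteq> 0"
      using e v by (auto simp: flow_balance_def)
    finally show False
      using circulation[of v] e v by auto
  qed
qed

lemma undirected_cycle_in_circulation_support:
  assumes "\<And>v. v \<in> verts G \<Longrightarrow> net_inflow d v = 0" and "e \<in> arcs G" and "d e \<noteq> 0"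
  shows "\<exists>vs es. undirected_cycle G vs es \<and> set es \<subseteq> {a \<in> arcs G. d a \<noteq> 0}"
  using assms by (intro undirected_cycle_if_leafless leafless_circulation_support) auto

end

subsection \<open>Identifying sets\<close>

context fin_digraph
begin

lemma arc_usable_if_b_flows_differ:
  assumes "b_flow b x" and "b_flow b y" and "e \<in> arcs G" and "x e \<noteq> y e"
  shows "e \<in> usable_arcs b"
proof -
  have "0 \<le> x e" and "0 \<le> y e"
    using assms by (auto simp: b_flow_def)
  then have "0 < x e \<or> 0 < y e"
    using assms(4) by linarith
  then show ?thesis
    using assms by (auto simp: usable_arcs_def)
qed

lemma undirected_cycle_if_not_identifying_b_flows:
  assumes "\<not> identifying S (b_flows b)"
  shows "\<exists>vs es. undirected_cycle G vs es \<and> set es \<subseteq> usable_arcs b - S"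
proof -
  obtain x y where x: "x \<in> extensional (arcs G)" "b_flow b x"
    and y: "y \<in> extensional (arcs G)" "b_flow b y"
    and "x \<noteq> y" and eq_on_S: "\<And>e. e \<in> S \<Longrightarrow> x e = y e"
    using assms by (auto simp: identifying_def b_flows_def)
  then obtain e where "e \<in> arcs G" "x e - y e \<noteq> 0"
    using extensionalityI[of x "arcs G" y] by auto
  moreover have "net_inflow (\<lambda>e. x e - y e) v = 0" if "v \<in> verts G" for v
    using x y that by (simp add: net_inflow_diff b_flow_def)
  ultimately obtain vs es
    where "undirected_cycle G vs es" "set es \<subseteq> {a \<in> arcs G. x a - y a \<noteq> 0}"
    using undirected_cycle_in_circulation_support[of "\<lambda>e. x e - y e"] by blast
  moreover have "{a \<in> arcs G. x a - y a \<noteq> 0} \<subseteq> usable_arcs b - S"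
    using arc_usable_if_b_flows_differ[OF x(2) y(2)] eq_on_S by auto
  ultimately show ?thesis
    by blast
qed

lemma not_identifying_b_flows_if_undirected_cycle:
  assumes cycle: "undirected_cycle G vs es" and es: "set es \<subseteq> usable_arcs b - S"
  shows "\<not> identifying S (b_flows b)"
proof -
  have "es \<noteq> []" and arcs: "set es \<subseteq> arcs G"
    using cycle by (auto simp: undirected_cycle_def)
  obtain x where x: "b_flow b x" "\<And>e. e \<in> set es \<Longrightarrow> 0 < x e"
    using ex_b_flow_pos_on_usable_arcs[of "set es" b] es \<open>es \<noteq> []\<close> by auto
  then obtain y where y: "b_flow b y" and differ: "\<And>e. x e \<noteq> y e \<longleftrightarrow> e \<in> set es"
    using b_flow_perturb_along_undirected_cycle[OF _ cycle] by blast
  have "restrict x (arcs G) (hd es) \<noteq> restrict y (arcs G) (hd es)"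
    using differ arcs hd_in_set[OF \<open>es \<noteq> []\<close>] by auto
  then have "restrict x (arcs G) \<noteq> restrict y (arcs G)"
    by metis
  moreover have "restrict x (arcs G) e = restrict y (arcs G) e" if "e \<in> S" for e
    using differ es that by (auto simp: restrict_def)
  ultimately show ?thesis
    using restrict_in_b_flows[OF x(1)] restrict_in_b_flows[OF y] unfolding identifying_def by blast
qed

theorem identifying_b_flows_iff:
  "identifying S (b_flows b) \<longleftrightarrow>
    \<not> (\<exists>vs es. undirected_cycle G vs es \<and> set es \<subseteq> usable_arcs b - S)"
  using undirected_cycle_if_not_identifying_b_flows not_identifying_b_flows_if_undirected_cycle
  by blast

end

theorem theorem4p1:
  fixes G :: "('a, 'b) pre_digraph" and s t :: 'a and S :: "'b set"
  assumes "fin_digraph G"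
    and "s \<in> verts G" and "t \<in> verts G"
    and "\<exists>p. pre_digraph.apath G s p t"
    and "S \<subseteq> arcs G"
  shows "identifying S (unit_flows G s t) \<longleftrightarrow>
    \<not> (\<exists>vs es. undirected_cycle (G\<lparr>arcs := path_or_cycle_arcs G s t - S\<rparr>) vs es)"
proof -
  interpret fin_digraph G
    by fact
  have usable: "usable_arcs (flow_balance s t) = path_or_cycle_arcs G s t"
    using assms(4) usable_arcs_flow_balance_subset path_or_cycle_arcs_subset_usable_arcs by blast
  have "path_or_cycle_arcs G s t - S \<subseteq> arcs G"
    by (auto simp: path_or_cycle_arcs_def)
  note cycle_iff = undirected_cycle_arcs_update_iff[OF this]
  show ?thesis
    unfolding unit_flows_eq_b_flows identifying_b_flows_iff usable cycle_iff ..
qed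

end
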